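(* Every ($2K_2$, paw)-free graph $G$ on $n$ vertices is recolorable, and the diameter of $R_\ell(G)$ is at most $2n^2$ for all $\ell\ge\chi(G)+1$.
   Context: All graphs are finite and simple. A $k$-coloring of $G$ is a map $V(G)\to\{1,\dots,k\}$ giving adjacent vertices different values; $\chi(G)$ is the chromatic number. $R_k(G)$ denotes the graph whose vertices are the $k$-colorings of $G$, two being adjacent if they differ in color on exactly one vertex. $G$ is recolorable if $R_\ell(G)$ is connected for all $\ell\ge\chi(G)+1$. A graph is $(H_1,H_2)$-free if it has no induced subgraph isomorphic to $H_1$ or $H_2$. $2K_2$ is the disjoint union of two edges; the paw is a triangle together with one extra vertex adjacent to exactly one vertex of the triangle. *)

theory Defs
  imports "Graph_Theory.Graph_Theory"
begin

text \<open>Finite simple graphs are terms satisfying \<^locale>\<open>pair_graph\<close>: finite, loopless, symmetric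
  arc relations. Every undirected edge is thus represented by its two orientations.\<close>

definition sym_graph :: "'a set \<Rightarrow> 'a rel \<Rightarrow> 'a pair_pre_digraph" where
  "sym_graph V E = \<lparr> pverts = V, parcs = E \<union> E\<inverse> \<rparr>"

definition two_K2 :: "nat pair_pre_digraph" where
  "two_K2 = sym_graph {0, 1, 2, 3} {(0, 1), (2, 3)}"

definition paw :: "nat pair_pre_digraph" where
  "paw = sym_graph {0, 1, 2, 3} {(0, 1), (1, 2), (0, 2), (2, 3)}"

definition induced_free :: "('c, 'd) pre_digraph \<Rightarrow> ('a, 'b) pre_digraph \<Rightarrow> bool" where
  "induced_free H G \<longleftrightarrow> \<not> (\<exists>S. induced_subgraph S G \<and> digraph_iso S H)"

text \<open>Colorings are extensional functions, so that two colorings are equal iff they agree on the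
  vertices of the graph.\<close>

definition colorings :: "nat \<Rightarrow> 'a pair_pre_digraph \<Rightarrow> ('a \<Rightarrow> nat) set" where
  "colorings k G = {c \<in> pverts G \<rightarrow>\<^sub>E {1..k}. \<forall>(u, v) \<in> parcs G. c u \<noteq> c v}"

definition chromatic_number :: "'a pair_pre_digraph \<Rightarrow> nat" where
  "chromatic_number G = (LEAST k. colorings k G \<noteq> {})"

definition reconfiguration_graph :: "nat \<Rightarrow> 'a pair_pre_digraph \<Rightarrow> ('a \<Rightarrow> nat) pair_pre_digraph" where
  "reconfiguration_graph k G =
    \<lparr> pverts = colorings k G,
      parcs = {(c, d) \<in> colorings k G \<times> colorings k G. \<exists>!v. v \<in> pverts G \<and> c v \<noteq> d v} \<rparr>"

definition recolorable :: "'a pair_pre_digraph \<Rightarrow> bool" where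
  "recolorable G \<longleftrightarrow>
    (\<forall>l \<ge> chromatic_number G + 1.
       Digraph_Component.connected (with_proj (reconfiguration_graph l G)))"

text \<open>With unit weights, \<open>wf_digraph.\<mu>\<close> is the usual distance, infinite between vertices in
  different components. Like \<open>wf_digraph.\<mu>\<close> itself, this is meaningful only for well-formed digraphs,
  and only for nonempty ones (otherwise the supremum is \<open>-\<infinity>\<close>).\<close>

definition graph_diameter :: "('a, 'b) pre_digraph \<Rightarrow> ereal" where
  "graph_diameter G = (SUP (u, v) \<in> verts G \<times> verts G. wf_digraph.\<mu> G (\<lambda>_. 1) u v)"

lemma pair_graph_reconfiguration_graph:
  assumes "pair_graph G"
  shows "pair_graph (reconfiguration_graph k G)"
proof -
  interpret pair_graph G by (rule assms)
  let ?R = "reconfiguration_graph k G"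
  have fin: "finite (colorings k G)"
    by (rule finite_subset[of _ "pverts G \<rightarrow>\<^sub>E {1..k}"])
      (auto simp: colorings_def intro!: finite_PiE pair_finite_verts)
  have sub: "parcs ?R \<subseteq> colorings k G \<times> colorings k G"
    by (auto simp: reconfiguration_graph_def)
  have "finite (parcs ?R)"
    using sub fin by (meson finite_SigmaI finite_subset)
  moreover have "sym (parcs ?R)"
    by (rule symI) (auto simp: reconfiguration_graph_def eq_commute)
  moreover have "c \<noteq> d" if "(c, d) \<in> parcs ?R" for c d
    using that by (auto simp: reconfiguration_graph_def)
  moreover have "pverts ?R = colorings k G"
    by (simp add: reconfiguration_graph_def)
  ultimately show ?thesis
    using fin sub by unfold_locales (auto simp: symmetric_def)
qed

end

theory Submission
  imports Defs
begin

text \<open>By induction on the graph, any two colorings are joined by a sequence in which every vertex is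
  recolored at most \<open>2n\<close> times. If \<open>N(u) \<subseteq> N(v)\<close> for distinct \<open>u\<close> and \<open>v\<close>, give \<open>u\<close> the color of \<open>v\<close>,
  let \<open>u\<close> imitate \<open>v\<close> along a sequence for the graph without \<open>u\<close>, and finally give \<open>u\<close> its target
  color: this costs \<open>u\<close> only two recolorings more than \<open>v\<close>. If there is no such pair, the graph is
  complete (when it contains a triangle) or the five-cycle, and both are recolored directly.\<close>

section \<open>Proper colorings and recoloring sequences on vertex subsets\<close>

locale loopless_symmetric =
  fixes E :: "'a rel"
  assumes sym_E: "sym E" and irrefl_E: "irrefl E"
begin

lemma E_commute: "(u, v) \<in> E \<longleftrightarrow> (v, u) \<in> E"
  using sym_E by (auto dest: symD)

lemma not_loop [simp]: "(u, u) \<notin> E"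
  using irrefl_E by (auto simp: irrefl_def)

definition nbrs :: "'a set \<Rightarrow> 'a \<Rightarrow> 'a set" where
  "nbrs V u = {w \<in> V. (u, w) \<in> E}"

text \<open>\<open>E\<close> stays fixed while \<open>V\<close> and \<open>C\<close> vary, so
  deleting a vertex or a color only shrinks a set. Values outside \<open>V\<close> are
  unconstrained: one function colors every induced subgraph.\<close>

definition proper :: "'a set \<Rightarrow> 'c set \<Rightarrow> ('a \<Rightarrow> 'c) \<Rightarrow> bool" where
  "proper V C f \<longleftrightarrow> (\<forall>v\<in>V. f v \<in> C) \<and> (\<forall>u\<in>V. \<forall>v\<in>V. (u, v) \<in> E \<longrightarrow> f u \<noteq> f v)"

lemma proper_subset: "proper V C f \<Longrightarrow> W \<subseteq> V \<Longrightarrow> proper W C f"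
  unfolding proper_def by blast

lemma proper_cong: "(\<And>v. v \<in> V \<Longrightarrow> f v = g v) \<Longrightarrow> proper V C f \<longleftrightarrow> proper V C g"
  unfolding proper_def by simp

lemma proper_fun_upd_iff:
  assumes "u \<in> V"
  shows "proper V C (f(u := b)) \<longleftrightarrow>
    proper (V - {u}) C f \<and> b \<in> C \<and> (\<forall>w\<in>nbrs V u. f w \<noteq> b)"
  using assms E_commute unfolding proper_def nbrs_def
  by (auto split: if_splits)

lemma proper_remove_iff:
  assumes "u \<in> V"
  shows "proper V C f \<longleftrightarrow>
    proper (V - {u}) C f \<and> f u \<in> C \<and> (\<forall>w\<in>nbrs V u. f w \<noteq> f u)"
  using proper_fun_upd_iff[OF assms, of C f "f u"] by simp

text \<open>A step may leave the coloring unchanged, so \<open>count M v\<close> is only an upper bound for the number of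
  color changes at \<open>v\<close>.\<close>

inductive recolors :: "'a set \<Rightarrow> 'c set \<Rightarrow> 'a multiset \<Rightarrow> ('a \<Rightarrow> 'c) \<Rightarrow> ('a \<Rightarrow> 'c) \<Rightarrow> bool"
  for V C where
  refl: "proper V C f \<Longrightarrow> recolors V C {#} f f"
| step: "recolors V C M f g \<Longrightarrow> v \<in> V \<Longrightarrow> proper V C (g(v := x)) \<Longrightarrow>
    recolors V C (add_mset v M) f (g(v := x))"

lemma recolors_proper:
  assumes "recolors V C M f g"
  shows "proper V C f" "proper V C g"
  using assms by (induction) simp_all

lemma recolors_trans:
  assumes "recolors V C M f g" "recolors V C N g h"
  shows "recolors V C (M + N) f h"
  using assms(2,1)
proof (induction)
  case (step N g h v x)
  then show ?case using recolors.step[of V C "M + N" f h v x] by (simp del: fun_upd_apply)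
qed simp

lemma recolors_single:
  assumes "proper V C f" "v \<in> V" "proper V C (f(v := x))"
  shows "recolors V C {#v#} f (f(v := x))"
  using recolors.step[OF recolors.refl[OF assms(1)] assms(2,3)] .

lemma recolors_set_mset: "recolors V C M f g \<Longrightarrow> set_mset M \<subseteq> V"
  by (induction rule: recolors.induct) auto

text \<open>Steps change values on \<open>V\<close> only, hence the agreement outside
  \<open>V\<close>. Bounding each vertex separately, not the total length, lets one vertex imitate
  another at controlled cost.\<close>

definition recolor_bound :: "'a set \<Rightarrow> 'c set \<Rightarrow> nat \<Rightarrow> bool" where
  "recolor_bound V C k \<longleftrightarrow>
    (\<forall>f g. proper V C f \<longrightarrow> proper V C g \<longrightarrow> (\<forall>v. v \<notin> V \<longrightarrow> f v = g v) \<longrightarrow>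
      (\<exists>M. recolors V C M f g \<and> (\<forall>v. count M v \<le> k)))"

lemma recolor_boundI:
  assumes "\<And>f g. proper V C f \<Longrightarrow> proper V C g \<Longrightarrow> (\<And>v. v \<notin> V \<Longrightarrow> f v = g v) \<Longrightarrow>
    \<exists>M. recolors V C M f g \<and> (\<forall>v. count M v \<le> k)"
  shows "recolor_bound V C k"
  using assms unfolding recolor_bound_def by blast

lemma recolor_boundE:
  assumes "recolor_bound V C k" "proper V C f" "proper V C g" "\<And>v. v \<notin> V \<Longrightarrow> f v = g v"
  obtains M where "recolors V C M f g" "\<And>v. count M v \<le> k"
  using assms unfolding recolor_bound_def by blast

lemma recolor_bound_empty: "recolor_bound {} C k"
proof (rule recolor_boundI)
  fix f g :: "'a \<Rightarrow> 'b"
  assume "proper {} C f" and "\<And>v. v \<notin> {} \<Longrightarrow> f v = g v"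
  then have "recolors {} C {#} f g"
    by (metis empty_iff ext recolors.refl)
  then show "\<exists>M. recolors {} C M f g \<and> (\<forall>v. count M v \<le> k)"
    by (intro exI[of _ "{#}"]) simp
qed


subsection \<open>Dominated vertices\<close>

definition dominated :: "'a set \<Rightarrow> 'a \<Rightarrow> 'a \<Rightarrow> bool" where
  "dominated V u v \<longleftrightarrow> u \<in> V \<and> v \<in> V \<and> u \<noteq> v \<and> nbrs V u \<subseteq> nbrs V v"

lemma dominated_not_adjacent: "dominated V u v \<Longrightarrow> (u, v) \<notin> E"
  unfolding dominated_def nbrs_def by auto

text \<open>Every neighbor of \<open>u\<close> in \<open>V\<close> is a neighbor of \<open>v\<close>
  other than \<open>u\<close>, so it avoids the color of \<open>v\<close>.\<close>

lemma proper_copy: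
  assumes "dominated V u v" "proper (V - {u}) C f"
  shows "proper V C (f(u := f v))"
proof -
  have "f w \<noteq> f v" if "w \<in> nbrs V u" for w
  proof -
    have "w \<in> V" "(v, w) \<in> E" "w \<noteq> u"
      using that assms(1) unfolding dominated_def nbrs_def by auto
    then show ?thesis
      using assms unfolding dominated_def proper_def by (metis DiffI singletonD)
  qed
  then show ?thesis
    using assms by (auto simp: dominated_def proper_fun_upd_iff) (auto simp: proper_def)
qed

text \<open>Whenever \<open>v\<close> changes color, \<open>u\<close> follows in the next step;
  other steps need no reaction of \<open>u\<close>.\<close>

lemma recolors_copy:
  assumes "recolors (V - {u}) C M f g" and dom: "dominated V u v"
  shows "recolors V C (M + replicate_mset (count M v) u) (f(u := f v)) (g(u := g v))"
  using assms(1)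
proof (induction)
  case (refl f)
  then show ?case
    using recolors.refl[OF proper_copy[OF dom refl]] by (simp del: fun_upd_apply)
next
  case (step M f g w x)
  have uv: "u \<in> V" "v \<in> V" "u \<noteq> v" using dom by (auto simp: dominated_def)
  have w: "w \<in> V" "w \<noteq> u" using step by auto
  have pr: "proper V C ((g(w := x))(u := (g(w := x)) v))"
    using proper_copy[OF dom] step.hyps by blast
  show ?case
  proof (cases "w = v")
    case False
    then have "(g(w := x))(u := (g(w := x)) v) = (g(u := g v))(w := x)"
      using w by auto
    then show ?thesis
      using recolors.step[OF step.IH, of w x] w pr False by (simp del: fun_upd_apply)
  next
    case True
    \<comment> \<open>Here \<open>v\<close> has moved to \<open>x\<close> while \<open>u\<close>
      keeps the old color of \<open>v\<close>. This is proper because \<open>u\<close> and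
      \<open>v\<close> are nonadjacent and no neighbor of \<open>u\<close> has the old
      color.\<close>
    let ?h = "(g(u := g v))(v := x)"
    have upd: "?h = (g(v := x))(u := g v)" using uv by auto
    have "g w \<noteq> g v" "w \<noteq> v" if "w \<in> nbrs V u" for w
      using that proper_copy[OF dom recolors_proper(2)[OF step.hyps(1)]] uv
        dominated_not_adjacent[OF dom]
      by (auto simp: proper_fun_upd_iff nbrs_def)
    moreover have "g v \<in> C"
      using recolors_proper(2)[OF step.hyps(1)] uv by (auto simp: proper_def)
    ultimately have "proper V C ?h"
      unfolding upd using step.hyps uv True by (auto simp: proper_fun_upd_iff)
    from recolors.step[OF step.IH uv(2) this]
    have *: "recolors V C (add_mset v (M + replicate_mset (count M v) u)) (f(u := f v)) ?h" .
    have "?h(u := x) = (g(w := x))(u := (g(w := x)) v)"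
      using True uv by auto
    then show ?thesis
      using recolors.step[OF * uv(1), of x] pr True by (simp del: fun_upd_apply)
  qed
qed

lemma recolor_bound_dominated:
  assumes bound: "recolor_bound (V - {u}) C k" and dom: "dominated V u v"
  shows "recolor_bound V C (k + 2)"
proof (rule recolor_boundI)
  fix f g :: "'a \<Rightarrow> 'b"
  assume f: "proper V C f" and g: "proper V C g" and out: "\<And>v. v \<notin> V \<Longrightarrow> f v = g v"
  have uv: "u \<in> V" "v \<in> V" "u \<noteq> v" using dom by (auto simp: dominated_def)
  \<comment> \<open>The target is altered at \<open>u\<close> to agree with \<open>f\<close> outside
    \<open>V - {u}\<close>, as \<open>recolor_bound\<close> demands; the very last step restores
    \<open>g u\<close>.\<close>
  have f': "proper (V - {u}) C f" and g': "proper (V - {u}) C (g(u := f u))"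
    using proper_subset[OF f, of "V - {u}"] proper_subset[OF g, of "V - {u}"]
      proper_cong[of "V - {u}" g "g(u := f u)"] by auto
  obtain M where M: "recolors (V - {u}) C M f (g(u := f u))" "\<And>v. count M v \<le> k"
    using recolor_boundE[OF bound f' g'] out by (metis DiffI fun_upd_apply singletonD)
  have Mu: "count M u = 0"
    using recolors_set_mset[OF M(1)] by (auto simp: count_eq_zero_iff)
  let ?N = "M + replicate_mset (count M v) u"
  have 1: "recolors V C {#u#} f (f(u := f v))"
    using recolors_single[OF f uv(1)] proper_copy[OF dom f'] by blast
  have 2: "recolors V C ?N (f(u := f v)) (g(u := g v))"
    using recolors_copy[OF M(1) dom] uv by simp
  have 3: "recolors V C {#u#} (g(u := g v)) g"
    using recolors_single[OF recolors_proper(2)[OF 2] uv(1), of "g u"] g by simp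
  have "recolors V C ({#u#} + ?N + {#u#}) f g"
    using recolors_trans[OF recolors_trans[OF 1 2] 3] .
  moreover have "count ({#u#} + ?N + {#u#}) w \<le> k + 2" for w
    using M(2)[of w] M(2)[of v] Mu by auto
  ultimately show "\<exists>M. recolors V C M f g \<and> (\<forall>v. count M v \<le> k + 2)" by blast
qed


subsection \<open>Vertices of small degree\<close>

text \<open>\<open>u\<close> moves only when a neighbor is about to take its color; the degree bound
  then leaves \<open>u\<close> another one. Each such move is charged to the neighbor's move, which
  gives the sum. The final color \<open>b\<close> is not controlled.\<close>

lemma recolors_lift_degree:
  assumes "recolors (V - {u}) C M f g" "proper V C f" "u \<in> V" "finite V" "finite C"
    and deg: "card (nbrs V u) + 1 < card C"
  shows "\<exists>N b. recolors V C N f (g(u := b)) \<and> (\<forall>w. w \<noteq> u \<longrightarrow> count N w = count M w) \<and>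
    count N u \<le> (\<Sum>w\<in>nbrs V u. count M w)"
  using assms(1,2)
proof (induction)
  case (refl f)
  then show ?case
    by (intro exI[of _ "{#}"] exI[of _ "f u"]) (simp add: recolors.refl)
next
  case (step M f g w x)
  then obtain N b where N: "recolors V C N f (g(u := b))"
    "\<And>w. w \<noteq> u \<Longrightarrow> count N w = count M w" "count N u \<le> (\<Sum>w\<in>nbrs V u. count M w)"
    by blast
  have fin: "finite (nbrs V u)" using \<open>finite V\<close> by (simp add: nbrs_def)
  have w: "w \<in> V" "w \<noteq> u" using step by auto
  have b: "b \<in> C" "\<And>z. z \<in> nbrs V u \<Longrightarrow> g z \<noteq> b" "proper (V - {u}) C g"
    using recolors_proper(2)[OF N(1)] \<open>u \<in> V\<close> by (auto simp: proper_fun_upd_iff)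
  have sum: "(\<Sum>z\<in>nbrs V u. count (add_mset w M) z) =
      (\<Sum>z\<in>nbrs V u. count M z) + (if w \<in> nbrs V u then 1 else 0)"
  proof -
    have "(\<Sum>z\<in>nbrs V u. count (add_mset w M) z) =
      (\<Sum>z\<in>nbrs V u. count M z + (if z = w then 1 else 0))"
      by (intro sum.cong) auto
    then show ?thesis using fin by (simp add: sum.distrib)
  qed
  show ?case
  proof (cases "w \<in> nbrs V u \<and> x = b")
    case False
    have "proper V C ((g(w := x))(u := b))"
      using step.hyps False b \<open>u \<in> V\<close> by (auto simp: proper_fun_upd_iff)
    moreover have "(g(w := x))(u := b) = (g(u := b))(w := x)" using w by auto
    ultimately have "recolors V C (add_mset w N) f ((g(w := x))(u := b))"
      using recolors.step[OF N(1) w(1), of x] by simp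
    moreover have "count (add_mset w N) z = count (add_mset w M) z" if "z \<noteq> u" for z
      using N(2)[OF that] by simp
    moreover have "count (add_mset w N) u \<le> (\<Sum>z\<in>nbrs V u. count (add_mset w M) z)"
      using N(3) sum w by simp
    ultimately show ?thesis by (intro exI conjI allI impI)
  next
    case True
    \<comment> \<open>The new color must avoid \<open>b\<close>, which \<open>w\<close> is about to
      take, and all current neighbor colors: at most degree plus one values.\<close>
    have "card (insert b (g ` nbrs V u)) \<le> card (nbrs V u) + 1"
      using card_image_le[OF fin, of g] fin by (simp add: card_insert_if)
    then have "\<not> C \<subseteq> insert b (g ` nbrs V u)"
      using deg fin by (meson card_mono finite_imageI finite_insert leD le_less_trans)
    then obtain b' where b': "b' \<in> C" "b' \<noteq> b" "\<And>z. z \<in> nbrs V u \<Longrightarrow> g z \<noteq> b'"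
      by blast
    have "proper V C ((g(u := b))(u := b'))"
      using b b' \<open>u \<in> V\<close> by (auto simp: proper_fun_upd_iff)
    from recolors.step[OF N(1) \<open>u \<in> V\<close> this]
    have *: "recolors V C (add_mset u N) f (g(u := b'))" by simp
    have "proper V C ((g(w := x))(u := b'))"
      using step.hyps b b' True \<open>u \<in> V\<close> by (auto simp: proper_fun_upd_iff)
    moreover have "(g(w := x))(u := b') = (g(u := b'))(w := x)" using w by auto
    ultimately have "recolors V C (add_mset w (add_mset u N)) f ((g(w := x))(u := b'))"
      using recolors.step[OF * w(1), of x] by simp
    moreover have "count (add_mset w (add_mset u N)) z = count (add_mset w M) z" if "z \<noteq> u" for z
      using N(2)[OF that] that by simp
    moreover have "count (add_mset w (add_mset u N)) u \<le>
        (\<Sum>z\<in>nbrs V u. count (add_mset w M) z)"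
      using N(3) sum w True by simp
    ultimately show ?thesis by (intro exI conjI allI impI)
  qed
qed

text \<open>The lifted sequence leaves \<open>u\<close> with an arbitrary color; one further move
  corrects it, hence the summand 1. Only neighbors already in \<open>V\<close> count, so a graph can
  be built along an order with few earlier neighbors.\<close>

lemma recolor_bound_insert:
  assumes bound: "recolor_bound V C k" and fin: "finite V" "finite C" and "u \<notin> V"
    and deg: "card (nbrs V u) + 1 < card C"
    and m: "k \<le> m" "1 + card (nbrs V u) * k \<le> m"
  shows "recolor_bound (insert u V) C m"
proof (rule recolor_boundI)
  fix f g :: "'a \<Rightarrow> 'b"
  let ?V = "insert u V"
  assume f: "proper ?V C f" and g: "proper ?V C g" and out: "\<And>v. v \<notin> ?V \<Longrightarrow> f v = g v"
  have V: "?V - {u} = V" using \<open>u \<notin> V\<close> by blast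
  have nb: "nbrs ?V u = nbrs V u" by (auto simp: nbrs_def)
  have f': "proper V C f" using proper_subset[OF f] by blast
  have g': "proper V C (g(u := f u))"
    using proper_subset[OF g, of V] proper_cong[of V "g(u := f u)" g C] \<open>u \<notin> V\<close>
    by (metis fun_upd_other subset_insertI)
  obtain M where M: "recolors V C M f (g(u := f u))" "\<And>v. count M v \<le> k"
    using recolor_boundE[OF bound f' g'] out by (metis fun_upd_apply insertE)
  obtain N b where N: "recolors ?V C N f (g(u := b))"
    "\<And>w. w \<noteq> u \<Longrightarrow> count N w = count M w" "count N u \<le> (\<Sum>w\<in>nbrs V u. count M w)"
    using recolors_lift_degree[of ?V u C M f "g(u := f u)"] M(1) V f fin deg nb by auto
  have "(\<Sum>w\<in>nbrs V u. count M w) \<le> card (nbrs V u) * k"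
    using sum_bounded_above[of "nbrs V u" "count M" k] M(2) by simp
  then have "count (add_mset u N) w \<le> m" for w
    using N(2)[of w] N(3) M(2)[of w] m by (cases "w = u") auto
  moreover have "recolors ?V C (add_mset u N) f g"
    using recolors.step[OF N(1), of u "g u"] g by simp
  ultimately show "\<exists>M. recolors ?V C M f g \<and> (\<forall>v. count M v \<le> m)" by blast
qed


subsection \<open>Cliques and the five-cycle\<close>

definition clique :: "'a set \<Rightarrow> bool" where
  "clique V \<longleftrightarrow> (\<forall>u\<in>V. \<forall>v\<in>V. u \<noteq> v \<longrightarrow> (u, v) \<in> E)"

lemma proper_freeze:
  assumes "proper (V - {u}) (C - {f u}) f" "f u \<in> C" "u \<in> V"
  shows "proper V C f"
proof -
  have "f w \<in> C - {f u}" if "w \<in> V - {u}" for w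
    using assms(1) that unfolding proper_def by blast
  moreover have "nbrs V u \<subseteq> V - {u}" by (auto simp: nbrs_def)
  moreover have "proper (V - {u}) C f" using assms(1) unfolding proper_def by blast
  ultimately show ?thesis
    using assms(2) unfolding proper_remove_iff[OF \<open>u \<in> V\<close>] by blast
qed

text \<open>While the other vertices avoid the color \<open>x\<close>, a vertex parked at
  \<open>x\<close> cannot conflict with them.\<close>

lemma recolors_freeze:
  assumes "recolors (V - {u}) (C - {x}) M f g" "f u = x" "x \<in> C" "u \<in> V"
  shows "recolors V C M f g \<and> g u = x"
  using assms(1,2)
proof (induction)
  case (refl f)
  then show ?case using proper_freeze[of V u C f] assms(3,4) by (simp add: recolors.refl)
next
  case (step M f g w y)
  then have gu: "(g(w := y)) u = x" by auto
  then have "proper V C (g(w := y))"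
    using proper_freeze[of V u C "g(w := y)"] step.hyps(3) assms(3,4) by simp
  then show ?case using step gu recolors.step[of V C M f g w y] by blast
qed

text \<open>Bring \<open>u\<close> to its target color first, then freeze \<open>u\<close> and
  delete that color from \<open>C\<close>: what remains is a smaller clique that still has a spare
  color. Preparing \<open>u\<close> costs every vertex at most one move, within the two allowed per
  induction step.\<close>

lemma recolor_bound_clique:
  assumes "finite V" "clique V" "finite C" "card V < card C"
  shows "recolor_bound V C (2 * card V)"
  using assms
proof (induction V arbitrary: C rule: finite_induct)
  case empty
  show ?case by (rule recolor_bound_empty)
next
  case (insert u V)
  let ?V = "insert u V"
  have cl: "clique V" using insert.prems by (simp add: clique_def)
  show ?case
  proof (rule recolor_boundI)
    fix f g :: "'a \<Rightarrow> 'b"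
    assume f: "proper ?V C f" and g: "proper ?V C g" and out: "\<And>v. v \<notin> ?V \<Longrightarrow> f v = g v"
    have gu: "g u \<in> C" using g by (simp add: proper_def)
    have inj: "h v \<noteq> h w" if "proper ?V C h" "v \<in> ?V" "w \<in> ?V" "v \<noteq> w" for h :: "'a \<Rightarrow> 'b" and v w
      using that insert.prems(1) unfolding clique_def proper_def by blast
    have "\<exists>M h. recolors ?V C M f h \<and> (\<forall>v. count M v \<le> 1) \<and> count M u = 0 \<and>
      (\<forall>v\<in>V. h v \<noteq> g u) \<and> (\<forall>v. v \<notin> ?V \<longrightarrow> h v = g v)"
    proof (cases "\<exists>w\<in>V. f w = g u")
      case False
      then show ?thesis
        using recolors.refl[OF f] out by (intro exI[of _ "{#}"] exI[of _ f]) auto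
    next
      case True
      then obtain w where w: "w \<in> V" "f w = g u" by blast
      have "card (f ` ?V) < card C"
        using card_image_le[of ?V f] insert.prems insert.hyps by simp
      then have "\<not> C \<subseteq> f ` ?V"
        using insert.hyps by (meson card_mono finite_imageI finite_insert leD)
      then obtain z where z: "z \<in> C" "z \<notin> f ` ?V" by blast
      then have "z \<noteq> g u" using w by (metis image_eqI insertCI)
      have "proper ?V C (f(w := z))"
        using w z proper_subset[OF f, of "?V - {w}"] by (auto simp: proper_fun_upd_iff nbrs_def)
      then have "recolors ?V C {#w#} f (f(w := z))"
        using recolors_single[OF f] w by simp
      moreover have "(f(w := z)) v \<noteq> g u" if "v \<in> V" for v
        using that inj[OF f, of v w] w \<open>z \<noteq> g u\<close> by auto
      ultimately show ?thesis
        using w out insert.hyps by (intro exI[of _ "{#w#}"] exI[of _ "f(w := z)"]) auto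
    qed
    then obtain M h where M: "recolors ?V C M f h" "\<And>v. count M v \<le> 1" "count M u = 0"
      and h: "\<And>v. v \<in> V \<Longrightarrow> h v \<noteq> g u" "\<And>v. v \<notin> ?V \<Longrightarrow> h v = g v" by blast
    let ?h = "h(u := g u)"
    have ph: "proper ?V C h" using recolors_proper(2)[OF M(1)] .
    have V: "?V - {u} = V" using insert.hyps by blast
    have ph': "proper ?V C ?h"
      using proper_subset[OF ph, of V] h gu V
      by (auto simp: proper_fun_upd_iff nbrs_def)
    have "card V < card (C - {g u})"
      using insert.prems insert.hyps gu by simp
    then have bound: "recolor_bound V (C - {g u}) (2 * card V)"
      using insert.IH[OF cl] insert.prems by simp
    have "g v \<noteq> g u" if "v \<in> V" for v
      using inj[OF g, of v u] that insert.hyps by auto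
    then have 1: "proper V (C - {g u}) g"
      using proper_subset[OF g, of V] by (auto simp: proper_def)
    have 2: "proper V (C - {g u}) ?h"
      using ph' h insert.hyps by (auto simp: proper_def)
    have 3: "?h v = g v" if "v \<notin> V" for v using that h by auto
    obtain N where N: "recolors V (C - {g u}) N ?h g" "\<And>v. count N v \<le> 2 * card V"
      using recolor_boundE[OF bound 2 1 3] by blast
    have "recolors ?V C N ?h g"
      using recolors_freeze[of ?V u C "g u" N ?h g] N(1) gu V by simp
    then have "recolors ?V C (M + {#u#} + N) f g"
      using recolors_trans recolors_trans[OF M(1) recolors_single[OF ph, of u]] ph' by blast
    moreover have "count (M + {#u#} + N) v \<le> 2 * card ?V" for v
      using M(2)[of v] N(2)[of v] insert.hyps by (auto simp: M(3))
    ultimately show "\<exists>M. recolors ?V C M f g \<and> (\<forall>v. count M v \<le> 2 * card ?V)" by blast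
  qed
qed

lemma card_clique_le:
  assumes "finite D" "clique V" "proper V D c"
  shows "card V \<le> card D"
proof -
  have "inj_on c V" "c ` V \<subseteq> D"
    using assms unfolding clique_def proper_def inj_on_def by blast+
  then show ?thesis using card_inj_on_le assms(1) by blast
qed

definition five_cycle :: "'a \<Rightarrow> 'a \<Rightarrow> 'a \<Rightarrow> 'a \<Rightarrow> 'a \<Rightarrow> bool" where
  "five_cycle p q r s t \<longleftrightarrow> distinct [p, q, r, s, t] \<and>
    (p, q) \<in> E \<and> (q, r) \<in> E \<and> (r, s) \<in> E \<and> (s, t) \<in> E \<and> (t, p) \<in> E \<and>
    (p, r) \<notin> E \<and> (q, s) \<notin> E \<and> (r, t) \<notin> E \<and> (s, p) \<notin> E \<and> (t, q) \<notin> E"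

text \<open>With at most two colors, vertices at distance two on the cycle agree, so
  \<open>p\<close>, \<open>r\<close> and \<open>t\<close> share a color although \<open>t\<close>
  and \<open>p\<close> are adjacent.\<close>

lemma five_cycle_colors:
  assumes "finite D" "five_cycle p q r s t" "proper {p, q, r, s, t} D c"
  shows "3 \<le> card D"
proof (rule ccontr)
  assume "\<not> 3 \<le> card D"
  then have *: "x = y \<or> y = z \<or> x = z" if "{x, y, z} \<subseteq> D" for x y z
    using card_mono[OF assms(1) that] by (auto simp: card_insert_if split: if_splits)
  have "c p \<noteq> c q" "c q \<noteq> c r" "c r \<noteq> c s" "c s \<noteq> c t" "c t \<noteq> c p"
    "c p \<in> D" "c q \<in> D" "c r \<in> D" "c s \<in> D" "c t \<in> D"
    using assms(2,3) by (auto simp: five_cycle_def proper_def)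
  then show False
    using *[of "c p" "c q" "c r"] *[of "c q" "c r" "c s"] *[of "c r" "c s" "c t"]
      *[of "c s" "c t" "c p"] by auto
qed

text \<open>The vertices enter in the order \<open>r\<close>, \<open>s\<close>, \<open>q\<close>,
  \<open>t\<close>, \<open>p\<close>, with 0, 1, 1, 1, 2 earlier neighbors. The insertion bound
  yields 1, 2, 3, 4, 9; the last is rounded up to 10, twice the number of vertices.\<close>

lemma recolor_bound_five_cycle:
  assumes cyc: "five_cycle p q r s t" and C: "finite C" "4 \<le> card C"
  shows "recolor_bound {p, q, r, s, t} C 10"
proof -
  note adj = cyc[unfolded five_cycle_def] E_commute
  have 1: "recolor_bound {r} C 1"
    using recolor_bound_insert[OF recolor_bound_empty[of C 0], of r 1] C by (simp add: nbrs_def)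
  have "nbrs {r} s = {r}" using adj by (auto simp: nbrs_def)
  then have 2: "recolor_bound {s, r} C 2"
    using recolor_bound_insert[OF 1, of s 2] C adj by auto
  have "nbrs {s, r} q = {r}" using adj by (auto simp: nbrs_def)
  then have 3: "recolor_bound {q, s, r} C 3"
    using recolor_bound_insert[OF 2, of q 3] C adj by auto
  have "nbrs {q, s, r} t = {s}" using adj by (auto simp: nbrs_def)
  then have 4: "recolor_bound {t, q, s, r} C 4"
    using recolor_bound_insert[OF 3, of t 4] C adj by auto
  have "nbrs {t, q, s, r} p = {q, t}" using adj by (auto simp: nbrs_def)
  then have "recolor_bound {p, t, q, s, r} C 10"
    using recolor_bound_insert[OF 4, of p 10] C adj by auto
  moreover have "{p, t, q, s, r} = {p, q, r, s, t}" by auto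
  ultimately show ?thesis by simp
qed


subsection \<open>Structure without dominated vertices\<close>

definition two_K2_free :: "'a set \<Rightarrow> bool" where
  "two_K2_free V \<longleftrightarrow> (\<forall>a\<in>V. \<forall>b\<in>V. \<forall>c\<in>V. \<forall>d\<in>V. (a, b) \<in> E \<longrightarrow> (c, d) \<in> E \<longrightarrow>
    {a, b} \<inter> {c, d} = {} \<longrightarrow> (a, c) \<in> E \<or> (a, d) \<in> E \<or> (b, c) \<in> E \<or> (b, d) \<in> E)"

definition paw_free :: "'a set \<Rightarrow> bool" where
  "paw_free V \<longleftrightarrow> (\<forall>a\<in>V. \<forall>b\<in>V. \<forall>c\<in>V. \<forall>d\<in>V.
    (a, b) \<in> E \<longrightarrow> (b, c) \<in> E \<longrightarrow> (a, c) \<in> E \<longrightarrow> (c, d) \<in> E \<longrightarrow>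
    d \<noteq> a \<longrightarrow> d \<noteq> b \<longrightarrow> (a, d) \<in> E \<or> (b, d) \<in> E)"

lemma two_K2_free_subset: "two_K2_free V \<Longrightarrow> W \<subseteq> V \<Longrightarrow> two_K2_free W"
  unfolding two_K2_free_def by (meson subsetD)

lemma paw_free_subset: "paw_free V \<Longrightarrow> W \<subseteq> V \<Longrightarrow> paw_free W"
  unfolding paw_free_def by (meson subsetD)

text \<open>A shared endpoint of the two edges would turn an excluded pair into an edge, so they are
  disjoint.\<close>

lemma two_K2_freeD:
  assumes "two_K2_free V" "a \<in> V" "b \<in> V" "c \<in> V" "d \<in> V" "(a, b) \<in> E" "(c, d) \<in> E"
    "(a, c) \<notin> E" "(a, d) \<notin> E" "(b, c) \<notin> E" "(b, d) \<notin> E"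
  shows False
proof -
  have "{a, b} \<inter> {c, d} = {}" using assms(6-) E_commute by auto
  then show False using assms unfolding two_K2_free_def by blast
qed

lemma paw_freeD:
  assumes "paw_free V" "a \<in> V" "b \<in> V" "c \<in> V" "d \<in> V"
    "(a, b) \<in> E" "(b, c) \<in> E" "(a, c) \<in> E" "(c, d) \<in> E" "d \<noteq> a" "d \<noteq> b"
  shows "(a, d) \<in> E \<or> (b, d) \<in> E"
  using assms unfolding paw_free_def by blast

text \<open>Every vertex outside a triangle has at least two neighbors on it. Hence every edge lies in a
  triangle and non-adjacent vertices are twins.\<close>

lemma clique_if_triangle:
  assumes K: "two_K2_free V" and P: "paw_free V" and nodom: "\<And>u v. \<not> dominated V u v"
    and tri: "a \<in> V" "b \<in> V" "c \<in> V" "(a, b) \<in> E" "(b, c) \<in> E" "(a, c) \<in> E"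
  shows "clique V"
proof -
  \<comment> \<open>A vertex without neighbors would be dominated by any other vertex.\<close>
  have nbr: "\<exists>y\<in>V. (x, y) \<in> E" if "x \<in> V" for x
  proof -
    have "\<exists>v\<in>V. v \<noteq> x" using tri by (metis not_loop)
    then show ?thesis using nodom[of x] that unfolding dominated_def nbrs_def by blast
  qed
  \<comment> \<open>Otherwise a neighbor \<open>y\<close> of \<open>x\<close> meets every triangle
    edge by \<open>K\<close>; two triangle vertices seen by \<open>y\<close> then form a paw with
    \<open>y\<close> and the pendant \<open>x\<close>.\<close>
  have meets: "(x, a) \<in> E \<or> (x, b) \<in> E \<or> (x, c) \<in> E"
    if x: "x \<in> V" and T: "a \<in> V" "b \<in> V" "c \<in> V" "(a, b) \<in> E" "(b, c) \<in> E" "(a, c) \<in> E"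
    for x a b c
  proof (rule ccontr)
    assume no: "\<not> ?thesis"
    obtain y where y: "y \<in> V" "(x, y) \<in> E" using nbr x by blast
    have paw: "False" if "a' \<in> V" "b' \<in> V" "(a', b') \<in> E" "(y, a') \<in> E" "(y, b') \<in> E"
      "(x, a') \<notin> E" "(x, b') \<notin> E" for a' b'
      using paw_freeD[OF P that(1,2) y(1) x that(3)] that y E_commute by metis
    show False
      using two_K2_freeD[OF K x y(1) T(1,2) y(2) T(4)]
        two_K2_freeD[OF K x y(1) T(2,3) y(2) T(5)]
        two_K2_freeD[OF K x y(1) T(1,3) y(2) T(6)]
        paw[OF T(1,2,4)] paw[OF T(2,3,5)] paw[OF T(1,3,6)] no by blast
  qed
  \<comment> \<open>One neighbor on the triangle forces a second, or \<open>x\<close> would be the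
    pendant of a paw. Vertices of the triangle itself satisfy the formula too.\<close>
  have two: "((x, a) \<in> E \<or> (x, b) \<in> E) \<and> ((x, b) \<in> E \<or> (x, c) \<in> E) \<and> ((x, a) \<in> E \<or> (x, c) \<in> E)"
    if x: "x \<in> V" and T: "a \<in> V" "b \<in> V" "c \<in> V" "(a, b) \<in> E" "(b, c) \<in> E" "(a, c) \<in> E"
    for x a b c
    using meets[OF x T] paw_freeD[OF P T(1,2,3) x] paw_freeD[OF P T(2,3,1) x]
      paw_freeD[OF P T(3,1,2) x] T E_commute by metis
  \<comment> \<open>Two neighbors \<open>p\<close>, \<open>q\<close> of \<open>w\<close> on the
    given triangle form a triangle with \<open>w\<close>; \<open>u\<close> sees two of its vertices,
    so one besides \<open>w\<close>.\<close>
  have edge_triangle: "\<exists>p\<in>V. (u, p) \<in> E \<and> (w, p) \<in> E"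
    if uw: "u \<in> V" "w \<in> V" "(u, w) \<in> E" for u w
  proof -
    obtain p q where pq: "p \<in> V" "q \<in> V" "(w, p) \<in> E" "(p, q) \<in> E" "(w, q) \<in> E"
      using two[OF uw(2) tri] tri E_commute by metis
    show ?thesis using two[OF uw(1,2) pq(1,2,3,4,5)] pq by blast
  qed
  show ?thesis
    unfolding clique_def
  proof (intro ballI impI, rule ccontr)
    fix u v assume uv: "u \<in> V" "v \<in> V" "u \<noteq> v" "(u, v) \<notin> E"
    \<comment> \<open>On the triangle \<open>u\<close>, \<open>w\<close>, \<open>p\<close> the
      vertex \<open>v\<close> misses \<open>u\<close>, so it sees both others.\<close>
    have "(v, w) \<in> E" if w: "w \<in> V" "(u, w) \<in> E" for w
    proof -
      obtain p where p: "p \<in> V" "(u, p) \<in> E" "(w, p) \<in> E"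
        using edge_triangle[OF uv(1) w] by blast
      show ?thesis using two[OF uv(2,1) w(1) p(1) w(2) p(3,2)] uv(4) E_commute by blast
    qed
    then have "dominated V u v" using uv by (auto simp: dominated_def nbrs_def)
    then show False using nodom by blast
  qed
qed

text \<open>Private neighbors of two nonadjacent vertices, linked by the absence of an induced pair
  of disjoint edges, yield a five-cycle. A further vertex would see two cycle vertices at distance
  two and be dominated by the one between them.\<close>

lemma five_cycle_if_triangle_free:
  assumes K: "two_K2_free V" and nodom: "\<And>u v. \<not> dominated V u v"
    and tf: "\<And>a b c. a \<in> V \<Longrightarrow> b \<in> V \<Longrightarrow> c \<in> V \<Longrightarrow> (a, b) \<in> E \<Longrightarrow> (b, c) \<in> E \<Longrightarrow> (a, c) \<notin> E"
    and "\<not> clique V"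
  obtains p q r s t where "five_cycle p q r s t" "V = {p, q, r, s, t}"
proof -
  obtain u v where uv: "u \<in> V" "v \<in> V" "u \<noteq> v" "(u, v) \<notin> E"
    using \<open>\<not> clique V\<close> by (auto simp: clique_def)
  have escape: "\<exists>w\<in>V. (x, w) \<in> E \<and> (y, w) \<notin> E" if "x \<in> V" "y \<in> V" "x \<noteq> y" for x y
    using nodom[of x y] that by (auto simp: dominated_def nbrs_def)
  obtain a where a: "a \<in> V" "(u, a) \<in> E" "(v, a) \<notin> E" using escape uv by metis
  obtain b where b: "b \<in> V" "(v, b) \<in> E" "(u, b) \<notin> E" using escape uv by metis
  have ab: "(a, b) \<in> E"
    using two_K2_freeD[OF K uv(1) a(1) uv(2) b(1) a(2) b(2) uv(4) b(3)] a(3) E_commute by blast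
  have "u \<noteq> b" using uv b E_commute by blast
  \<comment> \<open>The fifth vertex is a neighbor of \<open>u\<close> that \<open>b\<close> misses;
    the edges \<open>(u, c)\<close> and \<open>(v, b)\<close> can then be linked only by
    \<open>(v, c)\<close>.\<close>
  then obtain c where c: "c \<in> V" "(u, c) \<in> E" "(b, c) \<notin> E" using escape uv b by metis
  have cv: "(v, c) \<in> E"
    using two_K2_freeD[OF K uv(1) c(1) uv(2) b(1) c(2) b(2) uv(4) b(3)] c(3) E_commute by blast
  have cyc: "five_cycle u a b v c"
    unfolding five_cycle_def using uv a b c ab cv E_commute tf[OF a(1) uv(1) c(1)] not_loop
    by auto
  have Kedge: "\<exists>i\<in>{x, y}. \<exists>j\<in>{p, q}. (i, j) \<in> E"
    if "x \<in> V" "y \<in> V" "p \<in> V" "q \<in> V" "(x, y) \<in> E" "(p, q) \<in> E" for x y p q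
    using two_K2_freeD[OF K that] by blast
  \<comment> \<open>The five disjuncts are the pairs at distance two on the cycle.\<close>
  have hits: "(x, p) \<in> E \<and> (x, r) \<in> E \<or> (x, q) \<in> E \<and> (x, s) \<in> E \<or> (x, r) \<in> E \<and> (x, t) \<in> E \<or>
      (x, s) \<in> E \<and> (x, p) \<in> E \<or> (x, t) \<in> E \<and> (x, q) \<in> E"
    if cyc: "five_cycle p q r s t" "{p, q, r, s, t} \<subseteq> V" and x: "x \<in> V" "x \<notin> {p, q, r, s, t}"
    for p q r s t x
  proof -
    note C = cyc(1)[unfolded five_cycle_def]
    have V: "p \<in> V" "q \<in> V" "r \<in> V" "s \<in> V" "t \<in> V" using cyc(2) by auto
    have indep: "\<not> ((z, p) \<in> E \<and> (z, q) \<in> E)" "\<not> ((z, q) \<in> E \<and> (z, r) \<in> E)"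
      "\<not> ((z, r) \<in> E \<and> (z, s) \<in> E)" "\<not> ((z, s) \<in> E \<and> (z, t) \<in> E)"
      "\<not> ((z, t) \<in> E \<and> (z, p) \<in> E)" if "z \<in> V" for z
      using tf[OF that] V C by blast+
    have some: "(x, p) \<in> E \<or> (x, q) \<in> E \<or> (x, r) \<in> E \<or> (x, s) \<in> E \<or> (x, t) \<in> E"
    proof (rule ccontr)
      assume none: "\<not> ?thesis"
      \<comment> \<open>Such a \<open>y\<close> meets all five cycle edges; a vertex cover of a
        five-cycle contains two adjacent vertices, which gives a triangle.\<close>
      obtain y where y: "y \<in> V" "(x, y) \<in> E" using escape[OF x(1) V(1)] x by auto
      have "(y, p) \<in> E \<or> (y, q) \<in> E" "(y, q) \<in> E \<or> (y, r) \<in> E" "(y, r) \<in> E \<or> (y, s) \<in> E"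
        "(y, s) \<in> E \<or> (y, t) \<in> E" "(y, t) \<in> E \<or> (y, p) \<in> E"
        using Kedge[OF x(1) y(1) _ _ y(2)] V C none by blast+
      then show False using indep[OF y(1)] by blast
    qed
    \<comment> \<open>Compare the edge from \<open>x\<close> to a cycle vertex with the opposite
      cycle edge, whose ends both lie at distance two from that vertex.\<close>
    have "(x, p) \<in> E \<Longrightarrow> (x, r) \<in> E \<or> (x, s) \<in> E"
      using Kedge[of x p r s] x V C E_commute by blast
    moreover have "(x, q) \<in> E \<Longrightarrow> (x, s) \<in> E \<or> (x, t) \<in> E"
      using Kedge[of x q s t] x V C E_commute by blast
    moreover have "(x, r) \<in> E \<Longrightarrow> (x, t) \<in> E \<or> (x, p) \<in> E"
      using Kedge[of x r t p] x V C E_commute by blast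
    moreover have "(x, s) \<in> E \<Longrightarrow> (x, p) \<in> E \<or> (x, q) \<in> E"
      using Kedge[of x s p q] x V C E_commute by blast
    moreover have "(x, t) \<in> E \<Longrightarrow> (x, q) \<in> E \<or> (x, r) \<in> E"
      using Kedge[of x t q r] x V C E_commute by blast
    ultimately show ?thesis using some by blast
  qed
  have no_twin: "\<not> ((x, t) \<in> E \<and> (x, q) \<in> E)"
    if cyc: "five_cycle p q r s t" "{p, q, r, s, t} \<subseteq> V" and x: "x \<in> V" "x \<notin> {p, q, r, s, t}"
    for p q r s t x
  proof
    assume xtq: "(x, t) \<in> E \<and> (x, q) \<in> E"
    note C = cyc(1)[unfolded five_cycle_def]
    have V: "p \<in> V" "q \<in> V" "r \<in> V" "s \<in> V" "t \<in> V" using cyc(2) by auto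
    \<comment> \<open>This makes \<open>p\<close> dominate \<open>x\<close>. On the cycle
      \<open>x\<close> sees only \<open>q\<close> and \<open>t\<close>; off the cycle,
      \<open>w\<close> misses \<open>q\<close> and \<open>t\<close>, and every remaining pair of
      \<open>hits\<close> contains \<open>p\<close>.\<close>
    have "(p, w) \<in> E" if w: "w \<in> V" "(x, w) \<in> E" for w
    proof (cases "w \<in> {p, q, r, s, t}")
      case True
      then show ?thesis using tf[OF x(1)] V C w xtq E_commute by blast
    next
      case False
      have "(w, q) \<notin> E" "(w, t) \<notin> E" using tf[OF x(1) w(1)] w xtq V by blast+
      then show ?thesis using hits[OF cyc w(1) False] E_commute by blast
    qed
    then have "dominated V x p" using x V by (auto simp: dominated_def nbrs_def)
    then show False using nodom by blast
  qed
  \<comment> \<open>\<open>no_twin\<close> excludes one pair at distance two; the rotations exclude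
    the other four.\<close>
  have rotate: "five_cycle p q r s t \<Longrightarrow> five_cycle q r s t p" for p q r s t
    unfolding five_cycle_def using E_commute by auto
  have "V \<subseteq> {u, a, b, v, c}"
  proof
    fix x assume x: "x \<in> V"
    show "x \<in> {u, a, b, v, c}"
    proof (rule ccontr)
      assume out: "x \<notin> {u, a, b, v, c}"
      have sub: "{u, a, b, v, c} \<subseteq> V" using uv a b c by blast
      note c1 = rotate[OF cyc]
      note c2 = rotate[OF c1]
      note c3 = rotate[OF c2]
      note c4 = rotate[OF c3]
      show False
        using hits[OF cyc sub x out] no_twin[OF cyc _ x] no_twin[OF c1 _ x] no_twin[OF c2 _ x]
          no_twin[OF c3 _ x] no_twin[OF c4 _ x] sub out by auto
    qed
  qed
  then have "V = {u, a, b, v, c}" using uv a b c by blast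
  then show ?thesis using that cyc by blast
qed


subsection \<open>The bound on the number of recolorings\<close>

text \<open>The coloring \<open>c\<close> restricts to every subset, so \<open>D\<close> and
  \<open>C\<close> survive vertex deletions unchanged. At the end \<open>card D < card C\<close>
  supplies the spare color of a clique and the fourth color of a five-cycle.\<close>

lemma recolor_bound_two_K2_paw_free:
  assumes "finite V" "two_K2_free V" "paw_free V" "finite D" "proper V D c"
    and "finite C" "card D < card C"
  shows "recolor_bound V C (2 * card V)"
  using assms(1-3,5)
proof (induction V rule: finite_remove_induct)
  case empty
  show ?case by (rule recolor_bound_empty)
next
  case (remove V)
  show ?case
  proof (cases "\<exists>u v. dominated V u v")
    case True
    then obtain u v where dom: "dominated V u v" by blast
    then have u: "u \<in> V" by (simp add: dominated_def)
    have "recolor_bound (V - {u}) C (2 * card (V - {u}))"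
      using remove.IH[OF u] remove.prems proper_subset[of V D c "V - {u}"]
        two_K2_free_subset[of V "V - {u}"] paw_free_subset[of V "V - {u}"] by blast
    from recolor_bound_dominated[OF this dom] show ?thesis
      using card.remove[OF remove.hyps(1) u] by simp
  next
    case False
    show ?thesis
    proof (cases "clique V")
      case True
      then show ?thesis
        using recolor_bound_clique[OF remove.hyps(1) True assms(6)]
          card_clique_le[OF assms(4) True] remove.prems assms(7) by force
    next
      case nc: False
      have "(a, c) \<notin> E" if "a \<in> V" "b \<in> V" "c \<in> V" "(a, b) \<in> E" "(b, c) \<in> E" for a b c
        using clique_if_triangle[OF remove.prems(1,2) _ that] False nc by blast
      then obtain p q r s t where cyc: "five_cycle p q r s t" "V = {p, q, r, s, t}"
        using five_cycle_if_triangle_free[OF remove.prems(1)] False nc by metis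
      have "3 \<le> card D"
        using five_cycle_colors[OF assms(4) cyc(1)] remove.prems(3) cyc(2) by blast
      then have "recolor_bound V C 10"
        using recolor_bound_five_cycle[OF cyc(1) assms(6)] assms(7) cyc(2) by simp
      moreover have "card V = 5" using cyc by (simp add: five_cycle_def)
      ultimately show ?thesis by simp
    qed
  qed
qed

end


subsection \<open>Translation to the reconfiguration graph\<close>

text \<open>The image of \<open>\<phi>\<close> is the induced copy. The isomorphism must lead from
  the copy to \<open>H\<close>, so it is built from the inverse \<open>\<psi>\<close>.\<close>

lemma not_induced_free_if_embedding:
  assumes G: "pair_wf_digraph G" and H: "pair_wf_digraph H"
    and inj: "inj_on \<phi> (pverts H)" and sub: "\<phi> ` pverts H \<subseteq> pverts G"
    and arcs: "\<And>i j. i \<in> pverts H \<Longrightarrow> j \<in> pverts H \<Longrightarrow> (\<phi> i, \<phi> j) \<in> parcs G \<longleftrightarrow> (i, j) \<in> parcs H"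
  shows "\<not> induced_free (with_proj H) (with_proj G)"
proof -
  interpret G: pair_wf_digraph G by (rule G)
  interpret H: pair_wf_digraph H by (rule H)
  define S where "S = \<lparr>pverts = \<phi> ` pverts H, parcs = map_prod \<phi> \<phi> ` parcs H\<rparr>"
  define \<psi> where "\<psi> = the_inv_into (pverts H) \<phi>"
  define h where "h = \<lparr>iso_verts = \<psi>, iso_arcs = map_prod \<psi> \<psi>, iso_head = snd, iso_tail = fst\<rparr>"
  have \<psi>: "\<psi> (\<phi> i) = i" if "i \<in> pverts H" for i
    using that inj by (simp add: \<psi>_def the_inv_into_f_f)
  have S: "wf_digraph (with_proj S)"
    by unfold_locales (auto simp: S_def dest: H.arc_fst_in_verts H.arc_snd_in_verts)
  have "parcs S = {e \<in> parcs G. fst e \<in> pverts S \<and> snd e \<in> pverts S}"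
  proof (intro equalityI subsetI)
    fix e assume "e \<in> parcs S"
    then obtain i j where "e = (\<phi> i, \<phi> j)" "(i, j) \<in> parcs H" by (auto simp: S_def)
    then show "e \<in> {e \<in> parcs G. fst e \<in> pverts S \<and> snd e \<in> pverts S}"
      using arcs[of i j] H.wellformed' by (auto simp: S_def)
  next
    fix e assume "e \<in> {e \<in> parcs G. fst e \<in> pverts S \<and> snd e \<in> pverts S}"
    then obtain i j where "e = (\<phi> i, \<phi> j)" "e \<in> parcs G" "i \<in> pverts H" "j \<in> pverts H"
      by (cases e) (auto simp: S_def)
    then show "e \<in> parcs S" using arcs[of i j] by (force simp: S_def)
  qed
  then have "induced_subgraph (with_proj S) (with_proj G)"
    using S sub G.wf_digraph unfolding induced_subgraph_def subgraph_def
    by (auto simp: S_def)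
  moreover have "\<psi> ` pverts S = pverts H"
    using \<psi> by (force simp: S_def image_image)
  moreover have "map_prod \<psi> \<psi> ` parcs S = parcs H"
  proof -
    have "map_prod \<psi> \<psi> (map_prod \<phi> \<phi> e) = e" if "e \<in> parcs H" for e
      using that H.wellformed' \<psi> by (cases e) auto
    then show ?thesis by (simp add: S_def image_image)
  qed
  moreover have inj_\<psi>: "inj_on \<psi> (pverts S)"
    using \<psi> by (auto simp: S_def inj_on_def)
  moreover have "parcs S \<subseteq> pverts S \<times> pverts S"
    by (auto simp: S_def dest: H.wellformed')
  then have "inj_on (map_prod \<psi> \<psi>) (parcs S)"
    using map_prod_inj_on[OF inj_\<psi> inj_\<psi>] inj_on_subset by blast
  ultimately have "digraph_iso (with_proj S) (with_proj H)"
    unfolding digraph_iso_def pre_digraph.digraph_isomorphism_def app_iso_def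
    using S by (intro exI[of _ h]) (auto simp: h_def with_proj_def)
  with \<open>induced_subgraph (with_proj S) (with_proj G)\<close> show ?thesis
    unfolding induced_free_def by blast
qed

lemma pair_wf_digraph_sym_graph: "E \<subseteq> V \<times> V \<Longrightarrow> pair_wf_digraph (sym_graph V E)"
  by unfold_locales (auto simp: sym_graph_def)

lemma loopless_symmetric_parcs: "pair_graph G \<Longrightarrow> loopless_symmetric (parcs G)"
proof -
  assume "pair_graph G"
  then interpret pair_graph G .
  show ?thesis
    by unfold_locales (auto simp: sym_def irrefl_def dest: arcs_symmetric no_loops')
qed

lemma two_K2_free_if_induced_free:
  assumes "pair_graph G" "induced_free (with_proj two_K2) (with_proj G)"
  shows "loopless_symmetric.two_K2_free (parcs G) (pverts G)"
proof -
  interpret pair_graph G by (rule assms(1))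
  interpret L: loopless_symmetric "parcs G" by (rule loopless_symmetric_parcs[OF assms(1)])
  show ?thesis
    unfolding L.two_K2_free_def
  proof (intro ballI impI, rule ccontr)
    fix a b c d
    assume V: "a \<in> pverts G" "b \<in> pverts G" "c \<in> pverts G" "d \<in> pverts G"
      and E: "(a, b) \<in> parcs G" "(c, d) \<in> parcs G" "{a, b} \<inter> {c, d} = {}"
      and N: "\<not> ((a, c) \<in> parcs G \<or> (a, d) \<in> parcs G \<or> (b, c) \<in> parcs G \<or> (b, d) \<in> parcs G)"
    have ne: "a \<noteq> b" "c \<noteq> d" using E by (auto dest: no_loops')
    have sym: "(b, a) \<in> parcs G" "(d, c) \<in> parcs G"
      "(a, c) \<notin> parcs G" "(a, d) \<notin> parcs G" "(b, c) \<notin> parcs G" "(b, d) \<notin> parcs G"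
      "(c, a) \<notin> parcs G" "(d, a) \<notin> parcs G" "(c, b) \<notin> parcs G" "(d, b) \<notin> parcs G"
      using E N L.E_commute by blast+
    have "\<not> induced_free (with_proj two_K2) (with_proj G)"
    \<comment> \<open>Vertex \<open>i\<close> of \<open>two_K2\<close> goes to entry
      \<open>i\<close> of the list.\<close>
    proof (rule not_induced_free_if_embedding[where \<phi> = "(!) [a, b, c, d]"])
      show "pair_wf_digraph two_K2"
        unfolding two_K2_def by (rule pair_wf_digraph_sym_graph) auto
      show "inj_on ((!) [a, b, c, d]) (pverts two_K2)"
        using ne E by (auto simp: two_K2_def sym_graph_def)
      show "(!) [a, b, c, d] ` pverts two_K2 \<subseteq> pverts G"
        using V by (auto simp: two_K2_def sym_graph_def)
      show "([a, b, c, d] ! i, [a, b, c, d] ! j) \<in> parcs G \<longleftrightarrow> (i, j) \<in> parcs two_K2"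
        if "i \<in> pverts two_K2" "j \<in> pverts two_K2" for i j
      proof -
        have "i \<in> {0, 1, 2, 3}" "j \<in> {0, 1, 2, 3}"
          using that by (simp_all add: two_K2_def sym_graph_def)
        then show ?thesis
          by (elim insertE emptyE) (simp_all add: two_K2_def sym_graph_def E sym)
      qed
    qed unfold_locales
    then show False using assms(2) by blast
  qed
qed

lemma paw_free_if_induced_free:
  assumes "pair_graph G" "induced_free (with_proj paw) (with_proj G)"
  shows "loopless_symmetric.paw_free (parcs G) (pverts G)"
proof -
  interpret pair_graph G by (rule assms(1))
  interpret L: loopless_symmetric "parcs G" by (rule loopless_symmetric_parcs[OF assms(1)])
  show ?thesis
    unfolding L.paw_free_def
  proof (intro ballI impI, rule ccontr)
    fix a b c d
    assume V: "a \<in> pverts G" "b \<in> pverts G" "c \<in> pverts G" "d \<in> pverts G"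
      and E: "(a, b) \<in> parcs G" "(b, c) \<in> parcs G" "(a, c) \<in> parcs G" "(c, d) \<in> parcs G"
      and ne: "d \<noteq> a" "d \<noteq> b" and N: "\<not> ((a, d) \<in> parcs G \<or> (b, d) \<in> parcs G)"
    have ne': "a \<noteq> b" "b \<noteq> c" "a \<noteq> c" "c \<noteq> d" using E by (auto dest: no_loops')
    have sym: "(b, a) \<in> parcs G" "(c, b) \<in> parcs G" "(c, a) \<in> parcs G" "(d, c) \<in> parcs G"
      "(a, d) \<notin> parcs G" "(b, d) \<notin> parcs G" "(d, a) \<notin> parcs G" "(d, b) \<notin> parcs G"
      using E N L.E_commute by blast+
    have "\<not> induced_free (with_proj paw) (with_proj G)"
    \<comment> \<open>Index 2 is the vertex of \<open>paw\<close> that carries the pendant edge,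
      matching \<open>c\<close>.\<close>
    proof (rule not_induced_free_if_embedding[where \<phi> = "(!) [a, b, c, d]"])
      show "pair_wf_digraph paw"
        unfolding paw_def by (rule pair_wf_digraph_sym_graph) auto
      show "inj_on ((!) [a, b, c, d]) (pverts paw)"
        using ne ne' by (auto simp: paw_def sym_graph_def)
      show "(!) [a, b, c, d] ` pverts paw \<subseteq> pverts G"
        using V by (auto simp: paw_def sym_graph_def)
      show "([a, b, c, d] ! i, [a, b, c, d] ! j) \<in> parcs G \<longleftrightarrow> (i, j) \<in> parcs paw"
        if "i \<in> pverts paw" "j \<in> pverts paw" for i j
      proof -
        have "i \<in> {0, 1, 2, 3}" "j \<in> {0, 1, 2, 3}"
          using that by (simp_all add: paw_def sym_graph_def)
        then show ?thesis
          by (elim insertE emptyE) (simp_all add: paw_def sym_graph_def E sym)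
      qed
    qed unfold_locales
    then show False using assms(2) by blast
  qed
qed

section \<open>From recoloring sequences to walks and the diameter\<close>

lemma colorings_iff_proper:
  assumes "pair_graph G"
  shows "f \<in> colorings k G \<longleftrightarrow>
    f \<in> extensional (pverts G) \<and> loopless_symmetric.proper (parcs G) (pverts G) {1..k} f"
proof -
  interpret pair_graph G by (rule assms)
  interpret L: loopless_symmetric "parcs G" by (rule loopless_symmetric_parcs[OF assms])
  show ?thesis
    unfolding colorings_def L.proper_def PiE_def using wellformed' by fastforce
qed

text \<open>Steps that leave the coloring unchanged are no arcs and are dropped, hence only an
  inequality for the length.\<close>

lemma awalk_if_recolors:
  assumes "pair_graph G" "f \<in> colorings k G"
    and "loopless_symmetric.recolors (parcs G) (pverts G) {1..k} M f g"
  shows "\<exists>p. pre_digraph.awalk (with_proj (reconfiguration_graph k G)) f p g \<and> length p \<le> size M"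
proof -
  let ?R = "reconfiguration_graph k G"
  interpret L: loopless_symmetric "parcs G" by (rule loopless_symmetric_parcs[OF assms(1)])
  interpret R: pair_graph ?R by (rule pair_graph_reconfiguration_graph[OF assms(1)])
  show ?thesis
    using assms(3,2)
  proof (induction rule: L.recolors.induct)
    case (refl f)
    then have "R.awalk f [] f"
      by (simp add: R.awalk_Nil_iff) (simp add: reconfiguration_graph_def)
    then show ?case by (metis list.size(3) size_empty order_refl)
  next
    case (step M f g v x)
    then obtain p where p: "R.awalk f p g" "length p \<le> size M" by blast
    have g: "g \<in> colorings k G"
      using R.awalk_last_in_verts[OF p(1)] by (simp add: reconfiguration_graph_def)
    then have g': "g(v := x) \<in> colorings k G"
      using step.hyps by (auto simp: colorings_iff_proper[OF assms(1)] extensional_def)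
    show ?case
    proof (cases "g v = x")
      case True
      then have "g(v := x) = g" by auto
      then show ?thesis using p by (metis le_SucI size_add_mset)
    next
      case False
      then have "(g, g(v := x)) \<in> parcs ?R"
        using g g' step.hyps by (auto simp: reconfiguration_graph_def)
      then have "R.awalk f (p @ [(g, g(v := x))]) (g(v := x))"
        using p(1) R.wellformed' by (auto simp: R.awalk_simps)
      then show ?thesis using p(2) by (metis length_append_singleton size_add_mset Suc_le_mono)
    qed
  qed
qed

text \<open>Give all vertices distinct colors. This ensures that the minimum in
  \<open>chromatic_number\<close> is attained.\<close>

lemma colorings_card_nonempty:
  assumes "pair_graph G"
  shows "colorings (card (pverts G)) G \<noteq> {}"
proof -
  interpret pair_graph G by (rule assms)
  interpret L: loopless_symmetric "parcs G" by (rule loopless_symmetric_parcs[OF assms])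
  obtain h where h: "bij_betw h (pverts G) {1..card (pverts G)}"
    using finite_same_card_bij[OF pair_finite_verts, of "{1..card (pverts G)}"] by auto
  have "L.proper (pverts G) {1..card (pverts G)} (restrict h (pverts G))"
    using h no_loops' unfolding L.proper_def bij_betw_def inj_on_def by fastforce
  then show ?thesis using colorings_iff_proper[OF assms] by auto
qed

lemma reconfiguration_walk:
  assumes G: "pair_graph G"
    and free: "induced_free (with_proj two_K2) (with_proj G)" "induced_free (with_proj paw) (with_proj G)"
    and l: "chromatic_number G + 1 \<le> l" and fg: "f \<in> colorings l G" "g \<in> colorings l G"
  shows "\<exists>p. pre_digraph.awalk (with_proj (reconfiguration_graph l G)) f p g \<and>
    length p \<le> 2 * (card (pverts G))\<^sup>2"
proof -
  interpret pair_graph G by (rule G)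
  interpret L: loopless_symmetric "parcs G" by (rule loopless_symmetric_parcs[OF G])
  let ?V = "pverts G"
  let ?D = "{1..chromatic_number G}"
  have "colorings (chromatic_number G) G \<noteq> {}"
    unfolding chromatic_number_def using colorings_card_nonempty[OF G] by (rule LeastI)
  then obtain c where "L.proper ?V ?D c" using colorings_iff_proper[OF G] by blast
  then have bound: "L.recolor_bound ?V {1..l} (2 * card ?V)"
    using L.recolor_bound_two_K2_paw_free[of ?V ?D c "{1..l}"] pair_finite_verts l
      two_K2_free_if_induced_free[OF G free(1)] paw_free_if_induced_free[OF G free(2)] by simp
  have "f v = g v" if "v \<notin> ?V" for v
    using fg that by (auto simp: colorings_iff_proper[OF G] extensional_def)
  then obtain M where M: "L.recolors ?V {1..l} M f g" "\<And>v. count M v \<le> 2 * card ?V"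
    using L.recolor_boundE[OF bound] fg colorings_iff_proper[OF G] by metis
  \<comment> \<open>The support of \<open>M\<close> lies in \<open>?V\<close>, so there are at most
    \<open>card ?V\<close> summands.\<close>
  have "size M \<le> (\<Sum>v\<in>set_mset M. 2 * card ?V)"
    unfolding size_multiset_overloaded_eq using M(2) by (intro sum_mono) simp
  also have "\<dots> \<le> card ?V * (2 * card ?V)"
    using card_mono[OF pair_finite_verts L.recolors_set_mset[OF M(1)]] by simp
  finally have "size M \<le> 2 * (card ?V)\<^sup>2" by (simp add: power2_eq_square)
  then show ?thesis using awalk_if_recolors[OF G fg(1) M(1)] by (meson order_trans)
qed

theorem corollary4:
  fixes G :: "'a pair_pre_digraph" and n :: nat
  assumes "pair_graph G"
    and "n = card (pverts G)"
    and "induced_free (with_proj two_K2) (with_proj G)"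
    and "induced_free (with_proj paw) (with_proj G)"
  shows "recolorable G \<and>
    (\<forall>l \<ge> chromatic_number G + 1.
       graph_diameter (with_proj (reconfiguration_graph l G)) \<le> ereal (2 * (real n)\<^sup>2))"
proof -
  have "Digraph_Component.connected (with_proj (reconfiguration_graph l G)) \<and>
      graph_diameter (with_proj (reconfiguration_graph l G)) \<le> ereal (2 * (real n)\<^sup>2)"
    if l: "chromatic_number G + 1 \<le> l" for l
  proof
    let ?R = "reconfiguration_graph l G"
    interpret R: pair_graph ?R by (rule pair_graph_reconfiguration_graph[OF assms(1)])
    have verts: "pverts ?R = colorings l G" by (simp add: reconfiguration_graph_def)
    have walk: "\<exists>p. R.awalk f p g \<and> length p \<le> 2 * n\<^sup>2" if "f \<in> pverts ?R" "g \<in> pverts ?R" for f g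
      using reconfiguration_walk[OF assms(1,3,4) l] that assms(2) verts by blast
    \<comment> \<open>Connectedness demands a nonempty vertex set; an optimal coloring is also an
      \<open>l\<close>-coloring.\<close>
    have "colorings (chromatic_number G) G \<noteq> {}"
      unfolding chromatic_number_def using colorings_card_nonempty[OF assms(1)] by (rule LeastI)
    moreover have "colorings (chromatic_number G) G \<subseteq> colorings l G"
      using l by (fastforce simp: colorings_def PiE_def Pi_def)
    ultimately have "pverts ?R \<noteq> {}" using verts by blast
    moreover have "f \<rightarrow>\<^sup>*\<^bsub>with_proj ?R\<^esub> g" if "f \<in> pverts ?R" "g \<in> pverts ?R" for f g
      using walk[OF that] R.reachable_awalkI by blast
    ultimately show "Digraph_Component.connected (with_proj ?R)"
      using R.reachable_mk_symmetricI
      unfolding connected_def strongly_connected_def by simp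
    \<comment> \<open>The distance is an infimum over walks, so the cost of one walk, here its
      length, bounds it.\<close>
    have "R.\<mu> (\<lambda>_. 1) f g \<le> ereal (2 * (real n)\<^sup>2)" if "f \<in> pverts ?R" "g \<in> pverts ?R" for f g
    proof -
      obtain p where p: "R.awalk f p g" "length p \<le> 2 * n\<^sup>2" using walk[OF \<open>f \<in> _\<close> \<open>g \<in> _\<close>] by blast
      have "R.awalk_cost (\<lambda>_. 1) p = real (length p)"
        by (induction p) auto
      also have "\<dots> \<le> 2 * (real n)\<^sup>2"
        using p(2) by (metis of_nat_le_iff of_nat_mult of_nat_numeral of_nat_power)
      finally have "ereal (R.awalk_cost (\<lambda>_. 1) p) \<le> ereal (2 * (real n)\<^sup>2)" by simp
      then show ?thesis using R.min_cost_le_walk_cost[OF p(1), of "\<lambda>_. 1"] order_trans by blast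
    qed
    then show "graph_diameter (with_proj ?R) \<le> ereal (2 * (real n)\<^sup>2)"
      unfolding graph_diameter_def by (intro SUP_least) auto
  qed
  then show ?thesis by (simp add: recolorable_def)
qed

end
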